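(* Let $p\ge1$, $D=d/dz$, and let $L_p(z)$ be the power series solution of $$L_p(z)=C_{p-1}z^{2p}+\Delta_pL_p(z),\qquad \Delta_p=\sum_{l=1}^p\frac{\alpha_{l,p}}{l!}z^{l+2p+1}D^l,$$ with $C_{p-1}=\binom{2p-2}{p-1}/p$ and $\alpha_{l,p}=\sum_{s_1,\dots,s_p\ge0,\ \sum_i s_i=l,\ \sum_i is_i=p}\binom{l}{s_1,\dots,s_p}\prod_{m=1}^p\binom{2m}{m}^{s_m}$. Set $\ell_{p,n}=[z^n]L_p(z)$. Then, for fixed $p$ and $n\to\infty$, $$\ell_{p,(2p+1)n-1}\sim B_p\,\beta_p^{\,n-1}\,n^{\gamma_p}\,(n-1)!^p,$$ where $$B_p=C_{p-1}\prod_{k=1}^p\frac{1}{\Gamma\!\left(1+\frac{2(p-k)-1}{2p+1}\right)},\qquad \beta_p=\frac{(4p+2)^p}{p!},\qquad \gamma_p=\frac{p(p-2)}{2p+1}.$$ Moreover, as $p\to\infty$, $$B_p=C_{p-1}\exp\!\left(-\frac{2p+1}{2}\int_1^2\log\Gamma(x)\,dx\right)\left(1+O\!\left(\frac1p\right)\right).$$ *)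

theory Defs
  imports
    "HOL-Analysis.Analysis"
    "HOL-Computational_Algebra.Formal_Power_Series"
    "HOL-Library.Landau_Symbols"
begin

unbundle no vec_syntax
unbundle fps_syntax

text \<open>The Catalan number \<open>C\<^bsub>p-1\<^esub>\<close>; note the shift of the index.\<close>

definition C_coeff :: "nat \<Rightarrow> real" where
  "C_coeff p = real ((2 * p - 2) choose (p - 1)) / real p"

definition exponent_tuples :: "nat \<Rightarrow> nat \<Rightarrow> (nat \<Rightarrow> nat) set" where
  "exponent_tuples l p =
     {s \<in> {1..p} \<rightarrow>\<^sub>E UNIV. (\<Sum>i=1..p. s i) = l \<and> (\<Sum>i=1..p. i * s i) = p}"

definition alpha :: "nat \<Rightarrow> nat \<Rightarrow> real" where
  "alpha l p =
     (\<Sum>s\<in>exponent_tuples l p.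
        fact l / (\<Prod>i=1..p. fact (s i)) * (\<Prod>m=1..p. real ((2 * m) choose m) ^ s m))"

lemma finite_exponent_tuples: "finite (exponent_tuples l p)"
proof (rule finite_subset)
  show "exponent_tuples l p \<subseteq> {1..p} \<rightarrow>\<^sub>E {..l}"
  proof
    fix s assume s: "s \<in> exponent_tuples l p"
    have "s i \<le> l" if "i \<in> {1..p}" for i
      using s member_le_sum[of i "{1..p}" s] that by (auto simp: exponent_tuples_def)
    with s show "s \<in> {1..p} \<rightarrow>\<^sub>E {..l}"
      by (auto simp: exponent_tuples_def PiE_iff)
  qed
qed (auto intro: finite_PiE)

definition Delta :: "nat \<Rightarrow> real fps \<Rightarrow> real fps" where
  "Delta p F =
     (\<Sum>l=1..p. fps_const (alpha l p / fact l) * fps_X ^ (l + 2 * p + 1) * (fps_deriv ^^ l) F)"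

text \<open>The description is proper for every \<open>p\<close>: see \<open>L_series_ex1\<close> below.\<close>

definition L_series :: "nat \<Rightarrow> real fps" where
  "L_series p = (THE F. F = fps_const (C_coeff p) * fps_X ^ (2 * p) + Delta p F)"

lemma Delta_nth_cong:
  assumes "\<And>m. m < n \<Longrightarrow> F $ m = G $ m"
  shows "Delta p F $ n = Delta p G $ n"
proof -
  have deriv: "(fps_deriv ^^ l) F $ j = (fps_deriv ^^ l) G $ j" if "F $ (j + l) = G $ (j + l)" for l j
    using that by (induction l arbitrary: j) auto
  have "(fps_const c * fps_X ^ (l + 2 * p + 1) * (fps_deriv ^^ l) F) $ n =
        (fps_const c * fps_X ^ (l + 2 * p + 1) * (fps_deriv ^^ l) G) $ n" for c l
  proof (cases "n < l + 2 * p + 1")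
    case False
    then have "F $ (n - (l + 2 * p + 1) + l) = G $ (n - (l + 2 * p + 1) + l)"
      by (intro assms) auto
    from deriv[OF this] show ?thesis
      unfolding mult.assoc fps_mult_left_const_nth fps_X_power_mult_nth by simp
  qed (simp only: mult.assoc fps_mult_left_const_nth fps_X_power_mult_nth if_True)
  then show ?thesis
    by (simp only: Delta_def fps_sum_nth)
qed

lemma L_series_ex1: "\<exists>!F. F = fps_const (C_coeff p) * fps_X ^ (2 * p) + Delta p F"
proof -
  define T where "T F = fps_const (C_coeff p) * fps_X ^ (2 * p) + Delta p F" for F
  have T_cong: "T F $ n = T G $ n" if "\<And>m. m < n \<Longrightarrow> F $ m = G $ m" for F G n
    using Delta_nth_cong[OF that] by (simp add: T_def)
  define F where "F = Abs_fps (\<lambda>n. (T ^^ Suc n) 0 $ n)"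
  have step: "(T ^^ k) 0 $ m = (T ^^ Suc k) 0 $ m" if "m < k" for k m
    using that
  proof (induction k arbitrary: m)
    case (Suc k)
    show ?case
      using T_cong[of m "(T ^^ k) 0" "(T ^^ Suc k) 0"] Suc by simp
  qed simp
  have stable: "(T ^^ (Suc m + d)) 0 $ m = (T ^^ Suc m) 0 $ m" for m d
  proof (induction d)
    case (Suc d)
    then show ?case using step[of m "Suc m + d"] by simp
  qed simp
  have F_nth: "F $ m = (T ^^ n) 0 $ m" if "m < n" for m n
    using stable[of m "n - Suc m"] that by (simp add: F_def)
  have "T F $ n = F $ n" for n
    using T_cong[of n F "(T ^^ n) 0"] F_nth by (simp add: F_def)
  then have "F = T F" by (simp add: fps_eq_iff)
  moreover have "G = H" if G: "G = T G" and H: "H = T H" for G H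
  proof -
    have "G $ n = H $ n" for n
    proof (induction n rule: less_induct)
      case (less n)
      then show ?case using T_cong[of n G H] G H by simp
    qed
    then show ?thesis by (simp add: fps_eq_iff)
  qed
  ultimately show ?thesis unfolding T_def by blast
qed

lemma L_series_eq: "L_series p = fps_const (C_coeff p) * fps_X ^ (2 * p) + Delta p (L_series p)"
  unfolding L_series_def by (rule theI'[OF L_series_ex1])

definition ell :: "nat \<Rightarrow> nat \<Rightarrow> real" where
  "ell p n = L_series p $ n"

definition B_const :: "nat \<Rightarrow> real" where
  "B_const p =
     C_coeff p * (\<Prod>k=1..p. 1 / Gamma (1 + (2 * (real p - real k) - 1) / (2 * real p + 1)))"

definition beta_const :: "nat \<Rightarrow> real" where
  "beta_const p = (4 * real p + 2) ^ p / fact p"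

definition gamma_exponent :: "nat \<Rightarrow> real" where
  "gamma_exponent p = real p * (real p - 2) / (2 * real p + 1)"

end

theory Submission
  imports Defs
begin

text \<open>The differential equation is a two-term recurrence
  \<open>ell p (N + 2 p + 1) = Q N * ell p N\<close> with \<open>Q N = (\<Sum>l=1..p. alpha l p * (N choose l))\<close>. As
  \<open>alpha l p\<close> is the coefficient of \<open>z ^ p\<close> in the \<open>l\<close>-th power of \<open>(1 - 4 z) powr (- 1 / 2) - 1\<close>,
  the binomial theorem makes \<open>Q N\<close> the coefficient of \<open>z ^ p\<close> in \<open>(1 - 4 z) powr (- N / 2)\<close>, which
  is a product of linear factors in \<open>N\<close>. Hence the coefficients are products of shifted factorials and
  Gauss's limit for \<open>Gamma\<close> gives their growth. The logarithm of the constant is a midpoint sum for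
  \<open>ln Gamma\<close> with step \<open>2 / (2 p + 1)\<close>.\<close>

subsection \<open>The recurrence for the coefficients\<close>

text \<open>Induction on \<open>I\<close>: the binomial theorem splits off \<open>x j\<close>, and
  its summation index \<open>k\<close> becomes the value of the tuple at \<open>j\<close>.\<close>

lemma multinomial_fps:
  fixes x :: "'i \<Rightarrow> 'a :: field_char_0 fps"
  assumes "finite I"
  shows "(\<Sum>i\<in>I. x i) ^ l =
    (\<Sum>s | s \<in> I \<rightarrow>\<^sub>E UNIV \<and> (\<Sum>i\<in>I. s i) = l.
       fps_const (fact l / (\<Prod>i\<in>I. fact (s i))) * (\<Prod>i\<in>I. x i ^ s i))"
  using assms
proof (induction I arbitrary: l rule: finite_induct)
  case empty
  show ?case
  proof (cases "l = 0")
    case True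
    then have "{s. s \<in> {} \<rightarrow>\<^sub>E (UNIV :: nat set) \<and> (\<Sum>i\<in>{}. s i) = l} = {\<lambda>i::'i. undefined}"
      by auto
    with True show ?thesis by simp
  qed (simp add: power_0_left)
next
  case (insert j I)
  define T where "T I l = {s. s \<in> I \<rightarrow>\<^sub>E (UNIV :: nat set) \<and> (\<Sum>i\<in>I. s i) = l}" for I :: "'i set" and l
  define t where "t I l s = fps_const (fact l / (\<Prod>i\<in>I. fact (s i))) * (\<Prod>i\<in>I. x i ^ s i)"
    for I l and s :: "'i \<Rightarrow> nat"
  have fin: "finite (T I m)" for m
  proof (rule finite_subset)
    show "T I m \<subseteq> I \<rightarrow>\<^sub>E {..m}"
      using insert.hyps(1) by (force simp: T_def PiE_iff intro: member_le_sum)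
  qed (use insert.hyps in \<open>auto intro: finite_PiE\<close>)
  have upd: "(\<Sum>i\<in>I. (s(j := k)) i) = (\<Sum>i\<in>I. s i)"
    "(\<Prod>i\<in>I. fact ((s(j := k)) i)) = (\<Prod>i\<in>I. fact (s i) :: 'a)"
    "(\<Prod>i\<in>I. x i ^ (s(j := k)) i) = (\<Prod>i\<in>I. x i ^ s i)" for s k
    using insert.hyps by (auto intro!: sum.cong prod.cong)
  have coeff: "of_nat (l choose k) * x j ^ k * t I (l - k) s = t (insert j I) l (s(j := k))"
    if "k \<le> l" for k s
  proof -
    have "fps_const (of_nat (l choose k)) * fps_const (fact (l - k) / (\<Prod>i\<in>I. fact (s i))) =
      fps_const (fact l / (fact k * (\<Prod>i\<in>I. fact (s i))) :: 'a)"
      unfolding fps_const_mult using that by (simp add: binomial_fact field_simps)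
    then have "of_nat (l choose k) * fps_const (fact (l - k) / (\<Prod>i\<in>I. fact (s i))) =
      fps_const (fact l / (fact k * (\<Prod>i\<in>I. fact (s i))) :: 'a)"
      by (simp add: fps_of_nat)
    then show ?thesis
      using insert.hyps unfolding t_def
      by (simp add: upd del: fps_const_mult fun_upd_apply) (simp add: algebra_simps)
  qed
  have "(\<Sum>i\<in>insert j I. x i) ^ l = (x j + (\<Sum>i\<in>I. x i)) ^ l"
    using insert.hyps by simp
  also have "\<dots> = (\<Sum>k\<le>l. of_nat (l choose k) * x j ^ k * (\<Sum>i\<in>I. x i) ^ (l - k))"
    by (rule binomial_ring)
  also have "\<dots> = (\<Sum>k\<le>l. \<Sum>s\<in>T I (l - k). of_nat (l choose k) * x j ^ k * t I (l - k) s)"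
    unfolding insert.IH T_def t_def by (simp add: sum_distrib_left)
  also have "\<dots> = (\<Sum>(k, s)\<in>(SIGMA k:{..l}. T I (l - k)). of_nat (l choose k) * x j ^ k * t I (l - k) s)"
    using fin by (subst sum.Sigma) auto
  \<comment> \<open>Tuples are extensional, so removing the entry at \<open>j\<close> means
    resetting it to \<open>undefined\<close>.\<close>
  also have "\<dots> = (\<Sum>s\<in>T (insert j I) l. t (insert j I) l s)"
  proof (rule sum.reindex_bij_witness[where i = "\<lambda>s. (s j, s(j := undefined))" and j = "\<lambda>(k, s). s(j := k)"])
    fix s assume s: "s \<in> T (insert j I) l"
    then have "s j + (\<Sum>i\<in>I. s i) = l"
      using insert.hyps by (auto simp: T_def)
    with s show "(s j, s(j := undefined)) \<in> (SIGMA k:{..l}. T I (l - k))"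
      using insert.hyps by (auto simp: T_def PiE_iff extensional_def upd simp del: fun_upd_apply)
         (auto)
  next
    fix ks assume ks: "ks \<in> (SIGMA k:{..l}. T I (l - k))"
    then show "(case ks of (k, s) \<Rightarrow> s(j := k)) \<in> T (insert j I) l"
      using insert.hyps by (auto simp: T_def PiE_iff extensional_def upd simp del: fun_upd_apply)
         (auto)
    show "((case ks of (k, s) \<Rightarrow> s(j := k)) j, (case ks of (k, s) \<Rightarrow> s(j := k))(j := undefined)) = ks"
      using ks insert.hyps by (auto simp: T_def PiE_iff extensional_def fun_eq_iff)
    show "t (insert j I) l (case ks of (k, s) \<Rightarrow> s(j := k)) =
          (case ks of (k, s) \<Rightarrow> of_nat (l choose k) * x j ^ k * t I (l - k) s)"
      using ks coeff by auto
  qed auto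
  finally show ?case by (simp add: T_def t_def)
qed

text \<open>Each tuple contributes one monomial, of degree \<open>\<Sum>i=1..p. i * s i\<close>;
  taking the coefficient of \<open>z ^ p\<close> imposes the second condition in
  \<open>exponent_tuples\<close>.\<close>

lemma alpha_eq_power_nth:
  "alpha l p = ((\<Sum>m=1..p. fps_const (real ((2 * m) choose m)) * fps_X ^ m) ^ l) $ p"
proof -
  define T where "T = {s. s \<in> {1..p} \<rightarrow>\<^sub>E (UNIV :: nat set) \<and> (\<Sum>i=1..p. s i) = l}"
  define c where "c s = fact l / (\<Prod>i=1..p. fact (s i)) * (\<Prod>m=1..p. real ((2 * m) choose m) ^ s m)"
    for s :: "nat \<Rightarrow> nat"
  have fin: "finite T"
  proof (rule finite_subset)
    show "T \<subseteq> {1..p} \<rightarrow>\<^sub>E {..l}"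
      by (force simp: T_def PiE_iff intro: member_le_sum)
  qed (auto intro: finite_PiE)
  have const_prod: "(\<Prod>i\<in>I. fps_const (f i)) = fps_const (\<Prod>i\<in>I. f i :: real)" for f and I :: "nat set"
    by (induction I rule: infinite_finite_induct) simp_all
  have "(\<Prod>i=1..p. (fps_const (real ((2 * i) choose i)) * fps_X ^ i) ^ s i) =
     fps_const (\<Prod>m=1..p. real ((2 * m) choose m) ^ s m) * fps_X ^ (\<Sum>i=1..p. i * s i)" for s
    by (simp add: power_mult_distrib prod.distrib power_mult[symmetric] power_sum fps_const_power const_prod)
  then have "((\<Sum>m=1..p. fps_const (real ((2 * m) choose m)) * fps_X ^ m) ^ l) $ p =
     (\<Sum>s\<in>T. (fps_const (c s) * fps_X ^ (\<Sum>i=1..p. i * s i)) $ p)"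
    by (simp add: multinomial_fps T_def c_def fps_sum_nth mult.assoc[symmetric])
  also have "\<dots> = (\<Sum>s\<in>T. if (\<Sum>i=1..p. i * s i) = p then c s else 0)"
    by (intro sum.cong) auto
  also have "\<dots> = (\<Sum>s\<in>{s\<in>T. (\<Sum>i=1..p. i * s i) = p}. c s)"
    using fin by (simp add: sum.inter_filter)
  also have "{s\<in>T. (\<Sum>i=1..p. i * s i) = p} = exponent_tuples l p"
    by (auto simp: T_def exponent_tuples_def)
  finally show ?thesis by (simp add: alpha_def c_def)
qed

lemma alpha_eq_0:
  assumes "p < l"
  shows "alpha l p = 0"
proof -
  have "exponent_tuples l p = {}"
  proof (safe)
    fix s assume s: "s \<in> exponent_tuples l p"
    have "(\<Sum>i=1..p. s i) \<le> (\<Sum>i=1..p. i * s i)"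
      by (intro sum_mono) auto
    with s assms show "s \<in> {}" by (auto simp: exponent_tuples_def)
  qed
  then show ?thesis by (simp add: alpha_def)
qed

lemma alpha_0: "1 \<le> p \<Longrightarrow> alpha 0 p = 0"
  by (simp add: alpha_eq_power_nth)

text \<open>The series of \<open>(1 - 4 z) powr a\<close>; the generating function of the central binomial
  coefficients is the case \<open>a = -1/2\<close>.\<close>

definition binom4 :: "real \<Rightarrow> real fps" where
  "binom4 a = Abs_fps (\<lambda>n. (- 4) ^ n * (a gchoose n))"

text \<open>Vandermonde's convolution, once the powers of -4 are combined.\<close>

lemma binom4_add: "binom4 (a + b) = binom4 a * binom4 b"
proof (rule fps_ext)
  fix n
  have "(binom4 a * binom4 b) $ n = (\<Sum>k=0..n. (- 4) ^ n * ((a gchoose k) * (b gchoose (n - k))))"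
    by (auto simp: binom4_def fps_mult_nth power_add[symmetric] intro!: sum.cong)
  also have "\<dots> = binom4 (a + b) $ n"
    by (simp add: binom4_def gbinomial_Vandermonde flip: sum_distrib_left)
  finally show "binom4 (a + b) $ n = (binom4 a * binom4 b) $ n" by simp
qed

lemma binom4_power: "binom4 a ^ n = binom4 (real n * a)"
proof (induction n)
  case 0
  show ?case by (auto simp: binom4_def fps_eq_iff gbinomial_0_left)
qed (simp add: binom4_add ring_distribs)

text \<open>Duplication formula for \<open>fact (2 * n)\<close>; the sign in
  \<open>(- 4) ^ n\<close> cancels the sign of the generalized binomial coefficient.\<close>

lemma binom4_minus_half_nth: "binom4 (- 1 / 2) $ n = real ((2 * n) choose n)"
proof -
  have "real ((2 * n) choose n) = fact (2 * n) / (fact n * fact n)"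
    by (subst binomial_fact) (simp_all add: mult_2)
  also have "\<dots> = 2 ^ (2 * n) * pochhammer (1 / 2) n / fact n"
    by (subst fact_double) simp
  also have "\<dots> = (- 4) ^ n * ((- 1 / 2) gchoose n)"
    by (simp add: gbinomial_pochhammer power_mult flip: power_mult_distrib)
  finally show ?thesis by (simp add: binom4_def)
qed

lemma fps_power_nth_cong:
  fixes F G :: "'a :: comm_semiring_1 fps"
  assumes "\<And>i. i \<le> n \<Longrightarrow> F $ i = G $ i"
  shows "(F ^ k) $ n = (G ^ k) $ n"
  using assms by (induction k arbitrary: n) (auto simp: fps_mult_nth intro!: sum.cong)

lemma sum_alpha_binomial:
  assumes "1 \<le> p"
  shows "(\<Sum>l=1..p. alpha l p * real (N choose l)) = 4 ^ p * pochhammer (real N / 2) p / fact p"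
proof -
  define G where "G = (\<Sum>m=1..p. fps_const (real ((2 * m) choose m)) * fps_X ^ m)"
  have G_nth: "G $ i = (if i \<in> {1..p} then real ((2 * i) choose i) else 0)" for i
    by (simp add: G_def fps_sum_nth if_distrib cong: if_cong)
  \<comment> \<open>The range can be changed to \<open>l \<le> N\<close>: \<open>alpha l p\<close>
    vanishes for \<open>l = 0\<close> and for \<open>l > p\<close>, and the binomial coefficient
    vanishes for \<open>l > N\<close>.\<close>
  have "(\<Sum>l=1..p. alpha l p * real (N choose l)) = (\<Sum>l\<le>N + p. alpha l p * real (N choose l))"
    using assms alpha_0[of p] by (intro sum.mono_neutral_left) (auto simp: alpha_eq_0 not_le Suc_le_eq)
  also have "\<dots> = (\<Sum>l\<le>N. alpha l p * real (N choose l))"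
    by (intro sum.mono_neutral_right) auto
  also have "\<dots> = (\<Sum>l\<le>N. (of_nat (N choose l) * G ^ l) $ p)"
    by (simp add: alpha_eq_power_nth G_def mult.commute flip: fps_of_nat)
  also have "\<dots> = ((G + 1) ^ N) $ p"
    by (simp add: binomial_ring fps_sum_nth)
  \<comment> \<open>\<open>G + 1\<close> is the central binomial series truncated after degree
    \<open>p\<close>, which leaves coefficient \<open>p\<close> of its powers unchanged.\<close>
  also have "\<dots> = (binom4 (- 1 / 2) ^ N) $ p"
    by (intro fps_power_nth_cong) (auto simp: G_nth binom4_minus_half_nth[simplified])
  also have "\<dots> = 4 ^ p * pochhammer (real N / 2) p / fact p"
    unfolding binom4_power by (simp add: binom4_def gbinomial_pochhammer flip: power_mult_distrib)
  finally show ?thesis .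
qed

section \<open>Extracting coefficients from the differential equation\<close>

lemma fps_deriv_power_nth:
  fixes F :: "'a :: field_char_0 fps"
  shows "(fps_deriv ^^ l) F $ j = fact (j + l) / fact j * F $ (j + l)"
proof (induction l arbitrary: j)
  case (Suc l)
  have "(fps_deriv ^^ Suc l) F $ j = of_nat (Suc j) * (fact (Suc j + l) / fact (Suc j) * F $ (Suc j + l))"
    by (simp add: Suc.IH)
  also have "\<dots> = fact (j + Suc l) / fact j * F $ (j + Suc l)"
    by (simp add: fact_Suc[of j] del: of_nat_Suc fact_Suc)
  finally show ?case .
qed simp

text \<open>Multiplying the \<open>l\<close>-th derivative by \<open>z ^ (l + 2 * p + 1)\<close>
  shifts the index by \<open>2 * p + 1\<close> for every \<open>l\<close>; the falling factorial of
  \<open>N\<close> it produces, divided by \<open>fact l\<close>, is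
  \<open>N choose l\<close>.\<close>

lemma ell_rec:
  assumes "1 \<le> p"
  shows "ell p (N + (2 * p + 1)) = 4 ^ p * pochhammer (real N / 2) p / fact p * ell p N"
proof -
  \<comment> \<open>The index exceeds \<open>2 * p\<close>, so the inhomogeneous term does not
    contribute.\<close>
  have "ell p (N + (2 * p + 1)) = Delta p (L_series p) $ (N + (2 * p + 1))"
    unfolding ell_def by (subst L_series_eq) (simp add: fps_X_power_nth)
  also have "\<dots> = (\<Sum>l=1..p. alpha l p * real (N choose l) * ell p N)"
    unfolding Delta_def fps_sum_nth
  proof (intro sum.cong refl)
    fix l
    show "(fps_const (alpha l p / fact l) * fps_X ^ (l + 2 * p + 1) * (fps_deriv ^^ l) (L_series p))
        $ (N + (2 * p + 1)) = alpha l p * real (N choose l) * ell p N"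
    proof (cases "l \<le> N")
      case True
      then show ?thesis
        unfolding mult.assoc fps_mult_left_const_nth fps_X_power_mult_nth
        by (simp add: fps_deriv_power_nth ell_def binomial_fact)
    next
      case False
      then show ?thesis
        unfolding mult.assoc fps_mult_left_const_nth fps_X_power_mult_nth
        by simp
    qed
  qed
  also have "\<dots> = 4 ^ p * pochhammer (real N / 2) p / fact p * ell p N"
    by (simp only: sum_alpha_binomial[OF assms] flip: sum_distrib_right)
  finally show ?thesis .
qed

text \<open>All terms of \<open>Delta\<close> start at degree \<open>2 * p + 2\<close> or later. As
  \<open>2 * p = (2 * p + 1) * 1 - 1\<close>, the recurrence started here runs through the indices
  in the theorem.\<close>

lemma ell_initial: "ell p (2 * p) = C_coeff p"
proof -
  have "Delta p (L_series p) $ (2 * p) = 0"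
    unfolding Delta_def fps_sum_nth mult.assoc fps_mult_left_const_nth fps_X_power_mult_nth
    by (intro sum.neutral) auto
  then show ?thesis
    unfolding ell_def by (subst L_series_eq) simp
qed

subsection \<open>Asymptotics of the coefficients\<close>

text \<open>The negatives of these numbers are the roots in \<open>j\<close> of the recurrence
  factor at \<open>N = (2 * p + 1) * j - 1\<close>.\<close>

definition shift :: "nat \<Rightarrow> nat \<Rightarrow> real" where
  "shift p k = (2 * (real p - real k) - 1) / (2 * real p + 1)"

text \<open>For this \<open>N\<close>, the factor \<open>N / 2 + (p - k)\<close> is
  \<open>(2 * p + 1) / 2 * (shift p k + j)\<close>; giving each factor one 4 produces the base
  \<open>4 * p + 2\<close> of \<open>beta_const\<close>.\<close>

lemma rec_factor:
  assumes "1 \<le> j"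
  shows "4 ^ p * pochhammer (real ((2 * p + 1) * j - 1) / 2) p / fact p =
    beta_const p * (\<Prod>k=1..p. shift p k + real j)"
proof -
  define m where "m = 2 * real p + 1"
  have m: "m > 0" by (simp add: m_def)
  \<comment> \<open>\<open>1 \<le> j\<close> keeps the subtraction on naturals from
    truncating.\<close>
  have N: "real ((2 * p + 1) * j - 1) = m * real j - 1"
    using assms by (subst of_nat_diff) (auto simp: m_def algebra_simps)
  have "4 ^ p * pochhammer (real ((2 * p + 1) * j - 1) / 2) p =
      (\<Prod>i<p. 4 * ((m * real j - 1) / 2 + real i))"
    unfolding N by (simp only: pochhammer_prod prod.distrib prod_constant card_atLeastLessThan lessThan_atLeast0 diff_zero)
  also have "\<dots> = (\<Prod>k=1..p. 4 * ((m * real j - 1) / 2 + real (p - k)))"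
    by (rule prod.reindex_bij_witness[where i = "\<lambda>k. p - k" and j = "\<lambda>i. p - i"]) auto
  also have "\<dots> = (\<Prod>k=1..p. (4 * real p + 2) * (shift p k + real j))"
  proof (intro prod.cong refl)
    fix k assume k: "k \<in> {1..p}"
    then have "real (p - k) = real p - real k" by simp
    moreover have "4 * real p + 2 = 2 * m" "shift p k * m = 2 * (real p - real k) - 1"
      using m by (simp_all add: m_def shift_def)
    ultimately show "4 * ((m * real j - 1) / 2 + real (p - k)) = (4 * real p + 2) * (shift p k + real j)"
      by (simp add: field_simps)
  qed
  also have "\<dots> = (4 * real p + 2) ^ p * (\<Prod>k=1..p. shift p k + real j)"
    by (simp add: prod.distrib)
  finally show ?thesis by (simp add: beta_const_def)
qed

text \<open>The recurrence from \<open>Suc n\<close> to \<open>Suc (Suc n)\<close> supplies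
  \<open>shift p k + real (Suc n)\<close>, the next factor of
  \<open>pochhammer (1 + shift p k)\<close>.\<close>

lemma ell_closed_form:
  assumes "1 \<le> p"
  shows "ell p ((2 * p + 1) * Suc n - 1) =
    C_coeff p * beta_const p ^ n * (\<Prod>k=1..p. pochhammer (1 + shift p k) n)"
proof (induction n)
  case 0
  show ?case by (simp add: ell_initial)
next
  case (Suc n)
  have "(2 * p + 1) * Suc (Suc n) - 1 = (2 * p + 1) * Suc n - 1 + (2 * p + 1)"
    by simp
  then have "ell p ((2 * p + 1) * Suc (Suc n) - 1) =
      beta_const p * (\<Prod>k=1..p. shift p k + real (Suc n)) * ell p ((2 * p + 1) * Suc n - 1)"
    by (simp only: ell_rec[OF assms] rec_factor[of "Suc n" p, OF Suc_leI[OF zero_less_Suc, folded One_nat_def]])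
  also have "\<dots> = C_coeff p * beta_const p ^ Suc n *
      (\<Prod>k=1..p. pochhammer (1 + shift p k) n * (shift p k + real (Suc n)))"
    by (simp only: Suc.IH prod.distrib power_Suc) (simp add: algebra_simps)
  finally show ?case by (simp add: pochhammer_Suc algebra_simps)
qed

text \<open>The limit of \<open>Gamma_series'\<close>, whose Pochhammer symbol has \<open>n\<close>
  factors instead of \<open>n - 1\<close>; the extra factor \<open>n + a\<close> is compensated by
  \<open>n / (n + a)\<close>, which tends to 1.\<close>

lemma pochhammer_asymp_equiv:
  fixes a :: real
  assumes "a > -1"
  shows "(\<lambda>n. pochhammer (1 + a) (n - 1)) \<sim>[at_top] (\<lambda>n. 1 / Gamma (1 + a) * real n powr a * fact (n - 1))"
proof -
  have pos: "Gamma (1 + a) > 0" using assms by (intro Gamma_real_pos) auto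
  have "(\<lambda>n. Gamma (1 + a) / Gamma_series' (1 + a) n * (real n / (real n + a))) \<longlonglongrightarrow> Gamma (1 + a) / Gamma (1 + a) * 1"
  proof (intro tendsto_intros Gamma_series'_LIMSEQ)
    show "(\<lambda>n. real n / (real n + a)) \<longlonglongrightarrow> 1"
    proof (rule Lim_transform_eventually)
      show "(\<lambda>n. 1 / (1 + a / real n)) \<longlonglongrightarrow> 1"
        using tendsto_divide[OF tendsto_const tendsto_add[OF tendsto_const lim_const_over_n[of a]], of 1 1]
        by simp
      show "eventually (\<lambda>n. 1 / (1 + a / real n) = real n / (real n + a)) sequentially"
        by (intro eventually_sequentiallyI[of 1]) (simp add: field_simps)
    qed
  qed (use pos in auto)
  then have lim: "(\<lambda>n. Gamma (1 + a) / Gamma_series' (1 + a) n * (real n / (real n + a))) \<longlonglongrightarrow> 1"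
    using pos by simp
  have ev: "Gamma (1 + a) / Gamma_series' (1 + a) n * (real n / (real n + a)) =
      pochhammer (1 + a) (n - 1) / (1 / Gamma (1 + a) * real n powr a * fact (n - 1))" if n: "1 \<le> n" for n
  proof -
    obtain k where k: "n = Suc k" using n by (cases n) auto
    have p: "pochhammer (1 + a) k > 0" using assms by (intro pochhammer_pos) auto
    have e: "exp ((1 + a) * ln (real n)) = real n * real n powr a"
      using n by (simp add: powr_def distrib_right exp_add)
    have gs: "Gamma_series' (1 + a) n = fact k * (real n * real n powr a) / (pochhammer (1 + a) k * (real n + a))"
      unfolding Gamma_series'_def of_real_eq_id id_apply e
      by (simp add: k pochhammer_Suc add_ac)
    have "real n + a > 0" "real n > 0" "real n powr a > 0" "n - 1 = k" using n assms k by auto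
    with p pos show ?thesis
      by (simp add: gs divide_simps ac_simps)
  qed
  show ?thesis
  proof (rule asymp_equivI')
    show "(\<lambda>n. pochhammer (1 + a) (n - 1) / (1 / Gamma (1 + a) * real n powr a * fact (n - 1))) \<longlonglongrightarrow> 1"
      by (rule Lim_transform_eventually[OF lim]) (use ev in \<open>auto intro: eventually_sequentiallyI[of 1]\<close>)
  qed
qed

lemma asymp_equiv_prod:
  fixes f g :: "'i \<Rightarrow> 'a \<Rightarrow> real"
  assumes "\<And>i. i \<in> I \<Longrightarrow> f i \<sim>[F] g i"
  shows "(\<lambda>x. \<Prod>i\<in>I. f i x) \<sim>[F] (\<lambda>x. \<Prod>i\<in>I. g i x)"
  using assms by (induction I rule: infinite_finite_induct) (auto intro: asymp_equiv_mult)

lemma sum_shift: "(\<Sum>k=1..p. shift p k) = gamma_exponent p"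
proof -
  have "(\<Sum>k=1..p. 2 * (real p - real k) - 1) = real p * (real p - 2)"
  proof -
    \<comment> \<open>The limit \<open>n\<close> is separated from the \<open>x\<close> in the
      summand so that induction changes only the limit.\<close>
    have "(\<Sum>k=1..n. 2 * (x - real k) - 1) = real n * (2 * x - real n - 2)" for n x
      by (induction n) (auto simp: algebra_simps)
    from this[of "real p" p] show ?thesis by (simp add: algebra_simps)
  qed
  then show ?thesis
    by (simp add: shift_def gamma_exponent_def flip: sum_divide_distrib)
qed

text \<open>The smallest value, at \<open>k = p\<close>, is
  \<open>- 1 / (2 * p + 1)\<close>.\<close>

lemma shift_gt_minus_1: "1 \<le> k \<Longrightarrow> k \<le> p \<Longrightarrow> shift p k > -1"
  by (simp add: shift_def field_simps)

lemma ell_asymp_equiv: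
  assumes "1 \<le> p"
  shows "(\<lambda>n. ell p ((2 * p + 1) * n - 1)) \<sim>[at_top]
    (\<lambda>n. B_const p * beta_const p ^ (n - 1) * real n powr gamma_exponent p * fact (n - 1) ^ p)"
proof -
  let ?E = "\<lambda>n. C_coeff p * beta_const p ^ (n - 1) * (\<Prod>k=1..p. pochhammer (1 + shift p k) (n - 1))"
  let ?G = "\<lambda>n. C_coeff p * beta_const p ^ (n - 1) *
      (\<Prod>k=1..p. 1 / Gamma (1 + shift p k) * real n powr shift p k * fact (n - 1))"
  have "?E \<sim>[at_top] ?G"
    by (intro asymp_equiv_intros asymp_equiv_prod pochhammer_asymp_equiv shift_gt_minus_1) auto
  \<comment> \<open>At \<open>n = 0\<close> the subtractions truncate, so equality is claimed only
    eventually.\<close>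
  moreover have "eventually (\<lambda>n. ?E n = ell p ((2 * p + 1) * n - 1)) at_top"
    using eventually_ge_at_top[of 1]
  proof eventually_elim
    case (elim n)
    then show ?case using ell_closed_form[OF assms, of "n - 1"] by simp
  qed
  moreover have "eventually (\<lambda>n. ?G n = B_const p * beta_const p ^ (n - 1) * real n powr gamma_exponent p *
      fact (n - 1) ^ p) at_top"
    using eventually_ge_at_top[of 1]
  proof eventually_elim
    case (elim n)
    then have "(\<Prod>k=1..p. real n powr shift p k) = real n powr gamma_exponent p"
      by (simp add: powr_sum sum_shift[symmetric])
    then show ?case
      unfolding prod.distrib B_const_def shift_def by simp
  qed
  ultimately show ?thesis
    using asymp_equiv_cong by fastforce
qed

subsection \<open>Asymptotics of the constant\<close>

text \<open>Taylor expansion of the antiderivative \<open>F\<close> to third order on both sides of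
  \<open>c\<close>: the even terms cancel in the difference, leaving \<open>2 * t * f c\<close> and
  two cubic remainders.\<close>

lemma midpoint_rule_error:
  fixes F f f' f'' :: "real \<Rightarrow> real"
  assumes "0 < t"
    and F: "\<And>x. \<bar>x - c\<bar> \<le> t \<Longrightarrow> (F has_real_derivative f x) (at x)"
    and f: "\<And>x. \<bar>x - c\<bar> \<le> t \<Longrightarrow> (f has_real_derivative f' x) (at x)"
    and f': "\<And>x. \<bar>x - c\<bar> \<le> t \<Longrightarrow> (f' has_real_derivative f'' x) (at x)"
    and f'': "\<And>x. \<bar>x - c\<bar> \<le> t \<Longrightarrow> \<bar>f'' x\<bar> \<le> M"
  shows "\<bar>F (c + t) - F (c - t) - 2 * t * f c\<bar> \<le> M * t ^ 3 / 3"
proof -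
  define d where "d m = [F, f, f', f''] ! m" for m
  have d: "\<forall>m x. m < 3 \<and> c - t \<le> x \<and> x \<le> c + t \<longrightarrow> DERIV (d m) x :> d (Suc m) x"
    using F f f' by (auto simp: d_def less_Suc_eq numeral_3_eq_3 abs_le_iff)
  obtain u where u: "c < u" "u < c + t"
    "F (c + t) = (\<Sum>m<3. d m c / fact m * (c + t - c) ^ m) + d 3 u / fact 3 * (c + t - c) ^ 3"
    using Taylor_up[of 3 d F "c - t" "c + t" c] d \<open>0 < t\<close> by (auto simp: d_def)
  obtain v where v: "c - t < v" "v < c"
    "F (c - t) = (\<Sum>m<3. d m c / fact m * (c - t - c) ^ m) + d 3 v / fact 3 * (c - t - c) ^ 3"
    using Taylor_down[of 3 d F "c - t" "c + t" c] d \<open>0 < t\<close> by (auto simp: d_def)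
  have "F (c + t) - F (c - t) - 2 * t * f c = (f'' u + f'' v) * t ^ 3 / 6"
    using u(3) v(3) by (simp add: d_def numeral_3_eq_3 fact_numeral field_simps)
  moreover have "\<bar>f'' u + f'' v\<bar> \<le> 2 * M"
    using f''[of u] f''[of v] u v by auto
  then have "\<bar>(f'' u + f'' v) * t ^ 3 / 6\<bar> \<le> M * t ^ 3 / 3"
    using mult_right_mono[of "\<bar>f'' u + f'' v\<bar>" "2 * M" "t ^ 3"] \<open>0 < t\<close>
    by (simp add: abs_mult)
  ultimately show ?thesis by (simp only:)
qed

text \<open>The mean value inequality twice: since \<open>f b = 0\<close>, \<open>f\<close> is at
  most \<open>K * (b - a)\<close> in absolute value, which gains a second factor
  \<open>b - a\<close>.\<close>

lemma antiderivative_diff_bound: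
  fixes F f f' :: "real \<Rightarrow> real"
  assumes F: "\<And>x. x \<in> {a..b} \<Longrightarrow> (F has_real_derivative f x) (at x)"
    and f: "\<And>x. x \<in> {a..b} \<Longrightarrow> (f has_real_derivative f' x) (at x)"
    and f': "\<And>x. x \<in> {a..b} \<Longrightarrow> \<bar>f' x\<bar> \<le> K"
    and "a \<le> b" "f b = 0"
  shows "\<bar>F b - F a\<bar> \<le> K * (b - a) ^ 2"
proof -
  have K: "0 \<le> K" using f'[of a] \<open>a \<le> b\<close> by simp
  have "\<bar>f x\<bar> \<le> K * (b - a)" if x: "x \<in> {a..b}" for x
  proof -
    have "norm (f x - f b) \<le> K * norm (x - b)"
      by (rule field_differentiable_bound[of "{a..b}" f f'])
         (use x f f' \<open>a \<le> b\<close> in \<open>auto intro: has_field_derivative_at_within\<close>)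
    also have "\<dots> \<le> K * (b - a)" using x K by (intro mult_left_mono) auto
    finally show ?thesis using \<open>f b = 0\<close> by simp
  qed
  then have "norm (F b - F a) \<le> K * (b - a) * norm (b - a)"
    by (intro field_differentiable_bound[of "{a..b}" F f])
       (use F \<open>a \<le> b\<close> in \<open>auto intro: has_field_derivative_at_within\<close>)
  with \<open>a \<le> b\<close> show ?thesis by (simp add: power2_eq_square)
qed

lemma pos_notin_nonpos_Ints: "0 < x \<Longrightarrow> (x :: real) \<notin> \<int>\<^sub>\<le>\<^sub>0"
  by (auto elim!: nonpos_Ints_cases)

lemma Polygamma_bounded:
  assumes "0 < (a :: real)"
  shows "\<exists>M\<ge>0. \<forall>x\<in>{a..b}. \<bar>Polygamma n x\<bar> \<le> M"
proof -
  have "continuous_on {a..b} (Polygamma n :: real \<Rightarrow> real)"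
    using assms by (intro continuous_on_Polygamma) (auto dest: pos_notin_nonpos_Ints[rotated])
  then have "bounded (Polygamma n ` {a..b})"
    by (intro compact_imp_bounded compact_continuous_image) auto
  then obtain M where "\<forall>x\<in>{a..b}. \<bar>Polygamma n x\<bar> \<le> M"
    by (auto simp: bounded_iff)
  then show ?thesis by (intro exI[of _ "max 0 M"]) (auto simp: le_max_iff_disj)
qed

text \<open>\<open>ln_Gamma\<close> and \<open>ln (Gamma x)\<close> agree on the open positive
  half-line.\<close>

lemma has_real_derivative_ln_Gamma:
  assumes "0 < (x :: real)"
  shows "((\<lambda>x. ln (Gamma x)) has_real_derivative Digamma x) (at x)"
proof (rule DERIV_cong_ev[OF refl _ refl, THEN iffD1])
  show "(ln_Gamma has_real_derivative Digamma x) (at x)"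
    using assms by (rule has_field_derivative_ln_Gamma_real)
  show "eventually (\<lambda>y. ln_Gamma y = ln (Gamma y)) (nhds x)"
    using eventually_nhds_in_open[of "{0<..}" x] assms
    by (auto elim!: eventually_mono simp: ln_Gamma_real_pos)
qed

text \<open>With \<open>h = 2 / (2 p + 1)\<close> the points are the midpoints of a partition of
  \<open>{1 - h..2 - 3 h / 2}\<close> into intervals of length \<open>h\<close>. As \<open>ln (Gamma x)\<close> vanishes at \<open>1\<close> and
  at \<open>2\<close>, replacing this interval by \<open>{1..2}\<close> costs only \<open>O(h\<^sup>2)\<close>.\<close>

lemma ln_Gamma_midpoint_sum:
  obtains K :: real where "\<And>p. 1 \<le> p \<Longrightarrow>
    \<bar>(\<Sum>i<p. ln (Gamma (1 + (2 * real i - 1) / (2 * real p + 1)))) -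
      (2 * real p + 1) / 2 * integral {1..2} (\<lambda>x. ln (Gamma x))\<bar> \<le> K / real p"
proof -
  define f where "f x = ln (Gamma x)" for x :: real
  \<comment> \<open>All cells lie in \<open>{1 - h..2}\<close> with \<open>h \<le> 2 / 3\<close>,
    hence in \<open>{1/3..2}\<close>.\<close>
  have third: "0 < (1 / 3 :: real)" by simp
  obtain M where M: "0 \<le> M" "\<forall>x\<in>{1/3..2}. \<bar>Polygamma 1 x :: real\<bar> \<le> M"
    using Polygamma_bounded[OF third, of 2 1] by blast
  obtain K where K: "0 \<le> K" "\<forall>x\<in>{1/3..2}. \<bar>Digamma x :: real\<bar> \<le> K"
    using Polygamma_bounded[OF third, of 2 0] by blast
  have f: "(f has_real_derivative Digamma x) (at x)" if "0 < x" for x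
    unfolding f_def using that by (rule has_real_derivative_ln_Gamma)
  have f1: "(Digamma has_real_derivative Polygamma 1 x) (at x)" if "0 < (x :: real)" for x
    using has_field_derivative_Polygamma[OF pos_notin_nonpos_Ints[OF that], of 0] by simp
  \<comment> \<open>A larger interval, so that \<open>F\<close> below has a two-sided derivative on
    all of \<open>{1/3..2}\<close>.\<close>
  have cont: "continuous_on {1/4..3} f"
    by (rule DERIV_continuous_on, rule has_field_derivative_at_within, rule f) auto
  define F where "F x = integral {1/4..x} f" for x
  have F: "(F has_real_derivative f x) (at x)" if "x \<in> {1/3..2}" for x
  proof -
    have x: "1/4 < x" "x < 3" using that by auto
    then have "((\<lambda>x. integral {1/4..x} f) has_real_derivative f x) (at x within {1/4..3})"
      by (intro integral_has_real_derivative cont) auto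
    then show ?thesis
      unfolding F_def at_within_Icc_at[OF x] .
  qed
  have int: "F 2 - F 1 = integral {1..2} f"
  proof -
    have "f integrable_on {1/4..2}"
      by (intro integrable_continuous_real continuous_on_subset[OF cont]) auto
    then have "integral {1/4..1} f + integral {1..2} f = integral {1/4..2} f"
      by (intro Henstock_Kurzweil_Integration.integral_combine) auto
    then show ?thesis by (simp only: F_def)
  qed
  show thesis
  \<comment> \<open>\<open>M / 24\<close> comes from the midpoint rule with
    \<open>t = h / 2\<close>; the end pieces cost \<open>K\<close> and \<open>9 / 4 * K\<close>,
    together less than \<open>4 * K\<close>.\<close>
  proof (rule that[of "M / 24 + 4 * K"])
    fix p :: nat assume p: "1 \<le> p"
    define h where "h = 2 / (2 * real p + 1)"
    have h: "0 < h" "h \<le> 2 / 3" "h * real p \<le> 1" "h * real p = 1 - h / 2" "1 / h = (2 * real p + 1) / 2"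
      "h \<le> 1 / real p"
      using p by (auto simp: h_def field_simps)
    define S where "S = (\<Sum>i<p. f (1 + (real i - 1 / 2) * h))"
    have pt: "1 + (2 * real i - 1) / (2 * real p + 1) = 1 + (real i - 1 / 2) * h" for i
      by (simp add: h_def field_simps)
    have cell: "\<bar>F (1 + real i * h) - F (1 + (real i - 1) * h) - h * f (1 + (real i - 1 / 2) * h)\<bar>
        \<le> M * h ^ 3 / 24" if i: "i < p" for i
    proof -
      let ?c = "1 + (real i - 1 / 2) * h"
      have "real i \<le> real p - 1" using i by simp
      then have "real i * h \<le> (real p - 1) * h" using h by (intro mult_right_mono) auto
      also have "\<dots> \<le> 1 - h" using h by (simp add: algebra_simps)
      finally have ih: "real i * h \<le> 1 - h" .
      have range: "x \<in> {1/3..2}" if "\<bar>x - ?c\<bar> \<le> h / 2" for x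
      proof -
        have "x - ?c \<le> h / 2" "- (h / 2) \<le> x - ?c"
          using that by linarith+
        then have "1 + (real i - 1) * h \<le> x" "x \<le> 1 + real i * h"
          by (simp_all add: left_diff_distrib)
        moreover have "- h \<le> (real i - 1) * h" using h by (simp add: algebra_simps)
        ultimately show ?thesis using h ih by auto
      qed
      have "\<bar>F (?c + h / 2) - F (?c - h / 2) - 2 * (h / 2) * f ?c\<bar> \<le> M * (h / 2) ^ 3 / 3"
      proof (rule midpoint_rule_error)
        fix x assume "\<bar>x - ?c\<bar> \<le> h / 2"
        note x = range[OF this]
        then have "0 < x" by auto
        then show "(F has_real_derivative f x) (at x)" "(f has_real_derivative Digamma x) (at x)"
          "(Digamma has_real_derivative Polygamma 1 x) (at x)" "\<bar>Polygamma 1 x\<bar> \<le> M"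
          using x F f f1 M by auto
      qed (use h in auto)
      moreover have "?c + h / 2 = 1 + real i * h" "?c - h / 2 = 1 + (real i - 1) * h"
        by (simp_all add: algebra_simps)
      ultimately show ?thesis by (simp add: power_divide)
    qed
    have "(\<Sum>i<n. F (1 + real i * h) - F (1 + (real i - 1) * h)) = F (1 + (real n - 1) * h) - F (1 - h)" for n
      by (induction n) auto
    moreover have "1 + (real p - 1) * h = 2 - 3 / 2 * h"
      using h(4) by (simp add: algebra_simps)
    ultimately have "F (2 - 3 / 2 * h) - F (1 - h) - h * S =
        (\<Sum>i<p. F (1 + real i * h) - F (1 + (real i - 1) * h) - h * f (1 + (real i - 1 / 2) * h))"
      by (simp only: S_def sum_subtractf sum_distrib_left)
    also have "\<bar>\<dots>\<bar> \<le> (\<Sum>i<p. M * h ^ 3 / 24)"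
      by (rule order_trans[OF sum_abs sum_mono]) (use cell in auto)
    \<comment> \<open>There are \<open>p\<close> cells and \<open>h * p \<le> 1\<close>, so one
      power of \<open>h\<close> is lost.\<close>
    also have "\<dots> = M / 24 * h ^ 2 * (h * real p)" by (simp add: power3_eq_cube power2_eq_square)
    also have "\<dots> \<le> M / 24 * h ^ 2" using h M by (intro mult_left_le) auto
    finally have e1: "\<bar>F (2 - 3 / 2 * h) - F (1 - h) - h * S\<bar> \<le> M / 24 * h ^ 2" .
    have "\<bar>F 1 - F (1 - h)\<bar> \<le> K * (1 - (1 - h)) ^ 2"
      by (rule antiderivative_diff_bound[where f = f and f' = Digamma])
         (use h K F f in \<open>auto simp: f_def\<close>)
    then have e2: "\<bar>F 1 - F (1 - h)\<bar> \<le> K * h ^ 2" by simp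
    \<comment> \<open>The right gap has length \<open>3 / 2 * h\<close>; \<open>Gamma_fact\<close>
      at 1 gives \<open>Gamma 2 = 1\<close>, so \<open>f\<close> vanishes at 2.\<close>
    have "\<bar>F 2 - F (2 - 3 / 2 * h)\<bar> \<le> K * (2 - (2 - 3 / 2 * h)) ^ 2"
      by (rule antiderivative_diff_bound[where f = f and f' = Digamma])
         (use h K F f Gamma_fact[of 1, where ?'a = real] in \<open>auto simp: f_def\<close>)
    also have "K * (2 - (2 - 3 / 2 * h)) ^ 2 = 9 / 4 * (K * h ^ 2)"
      by (simp add: power2_eq_square)
    finally have e3: "\<bar>F 2 - F (2 - 3 / 2 * h)\<bar> \<le> 9 / 4 * (K * h ^ 2)" .
    have "\<bar>h * S - integral {1..2} f\<bar> \<le> (M / 24 + 4 * K) * h ^ 2"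
    proof -
      have "\<bar>h * S - integral {1..2} f\<bar> \<le> M / 24 * h ^ 2 + K * h ^ 2 + 9 / 4 * (K * h ^ 2)"
        using e1 e2 e3 unfolding int[symmetric] by linarith
      also have "\<dots> \<le> (M / 24 + 4 * K) * h ^ 2"
        using K by (simp add: algebra_simps)
      finally show ?thesis .
    qed
    then have "1 / h * \<bar>h * S - integral {1..2} f\<bar> \<le> 1 / h * ((M / 24 + 4 * K) * h ^ 2)"
      using h by (intro mult_left_mono) auto
    also have "\<dots> = (M / 24 + 4 * K) * h" using h by (simp add: power2_eq_square)
    also have "\<dots> \<le> (M / 24 + 4 * K) * (1 / real p)"
      using h M K by (intro mult_left_mono) auto
    also have "1 / h * \<bar>h * S - integral {1..2} f\<bar> = \<bar>1 / h * (h * S - integral {1..2} f)\<bar>"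
      using h by (simp add: abs_mult)
    also have "1 / h * (h * S - integral {1..2} f) = S - (2 * real p + 1) / 2 * integral {1..2} f"
      unfolding right_diff_distrib h(5) using h by (simp add: h_def)
    finally show "\<bar>(\<Sum>i<p. ln (Gamma (1 + (2 * real i - 1) / (2 * real p + 1)))) -
      (2 * real p + 1) / 2 * integral {1..2} (\<lambda>x. ln (Gamma x))\<bar> \<le> (M / 24 + 4 * K) / real p"
      unfolding pt S_def f_def by simp
  qed
qed

section \<open>From the midpoint sum to the constant\<close>

lemma B_const_eq_exp_sum:
  assumes "1 \<le> p"
  shows "B_const p = C_coeff p * exp (- (\<Sum>i<p. ln (Gamma (1 + (2 * real i - 1) / (2 * real p + 1)))))"
proof -
  have pos: "0 < Gamma (1 + (2 * real i - 1) / (2 * real p + 1))" for i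
    using assms by (intro Gamma_real_pos) (simp add: field_simps)
  have "(\<Prod>k=1..p. 1 / Gamma (1 + (2 * (real p - real k) - 1) / (2 * real p + 1))) =
      (\<Prod>i<p. 1 / Gamma (1 + (2 * real i - 1) / (2 * real p + 1)))"
    by (rule prod.reindex_bij_witness[where i = "\<lambda>i. p - i" and j = "\<lambda>k. p - k"]) (auto simp: of_nat_diff)
  also have "\<dots> = (\<Prod>i<p. exp (- ln (Gamma (1 + (2 * real i - 1) / (2 * real p + 1)))))"
    using pos by (intro prod.cong) (auto simp: exp_minus field_simps)
  also have "\<dots> = exp (- (\<Sum>i<p. ln (Gamma (1 + (2 * real i - 1) / (2 * real p + 1)))))"
    by (simp add: exp_sum sum_negf[symmetric] del: exp_ln)
  finally show ?thesis by (simp add: B_const_def)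
qed

text \<open>Turns an additive error in the exponent into a relative error; \<open>exp K\<close>
  bounds the derivative on \<open>{-K..K}\<close>.\<close>

lemma abs_exp_minus_one_le:
  fixes x K :: real
  assumes "\<bar>x\<bar> \<le> K"
  shows "\<bar>exp x - 1\<bar> \<le> exp K * \<bar>x\<bar>"
proof -
  have "norm (exp x - exp 0) \<le> exp K * norm (x - 0)"
    by (rule field_differentiable_bound[of "{-K..K}" exp exp])
       (use assms in \<open>auto intro!: derivative_eq_intros\<close>)
  then show ?thesis by simp
qed

lemma B_const_asymptotics:
  "\<exists>\<epsilon> :: nat \<Rightarrow> real. \<epsilon> \<in> O(\<lambda>p. 1 / real p) \<and>
    (\<forall>p\<ge>1. B_const p =
       C_coeff p * exp (- ((2 * real p + 1) / 2) * integral {1..2} (\<lambda>x :: real. ln (Gamma x))) * (1 + \<epsilon> p))"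
proof -
  define S I where "S p = (\<Sum>i<p. ln (Gamma (1 + (2 * real i - 1) / (2 * real p + 1))))"
    and "I p = (2 * real p + 1) / 2 * integral {1..2} (\<lambda>x. ln (Gamma x))" for p
  obtain K where K: "\<And>p. 1 \<le> p \<Longrightarrow> \<bar>S p - I p\<bar> \<le> K / real p"
    using ln_Gamma_midpoint_sum unfolding S_def I_def by blast
  \<comment> \<open>Defined as the exact relative error, so that the identity holds for every
    \<open>p \<ge> 1\<close>.\<close>
  define \<epsilon> where "\<epsilon> p = exp (I p - S p) - 1" for p
  have "\<bar>\<epsilon> p\<bar> \<le> exp K * K * \<bar>1 / real p\<bar>" if p: "1 \<le> p" for p
  proof -
    have "0 \<le> K" using K[of 1] by simp
    \<comment> \<open>This keeps the exponents in a fixed bounded range, making the factor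
      \<open>exp K\<close> uniform in \<open>p\<close>.\<close>
    then have "K / real p \<le> K" using p by (simp add: divide_le_eq mult_le_cancel_left1)
    then have "\<bar>\<epsilon> p\<bar> \<le> exp K * \<bar>I p - S p\<bar>"
      unfolding \<epsilon>_def using K[OF p] by (intro abs_exp_minus_one_le) (simp add: abs_minus_commute)
    also have "\<dots> \<le> exp K * (K / real p)"
      using K[OF p] by (intro mult_left_mono) (simp_all add: abs_minus_commute)
    finally show ?thesis by simp
  qed
  then have "\<epsilon> \<in> O(\<lambda>p. 1 / real p)"
    by (intro bigoI[of _ "exp K * K"] eventually_sequentiallyI[of 1]) simp
  moreover have "B_const p = C_coeff p * exp (- ((2 * real p + 1) / 2) * integral {1..2} (\<lambda>x. ln (Gamma x))) * (1 + \<epsilon> p)"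
    if "1 \<le> p" for p
  proof -
    have "B_const p = C_coeff p * exp (- S p)"
      using B_const_eq_exp_sum[OF that] by (simp only: S_def)
    also have "exp (- S p) = exp (- I p) * (1 + \<epsilon> p)"
      by (simp add: \<epsilon>_def flip: exp_add)
    finally show ?thesis by (simp add: I_def)
  qed
  ultimately show ?thesis by blast
qed

theorem theorem1:
  shows "(\<forall>p\<ge>1. (\<lambda>n. ell p ((2 * p + 1) * n - 1))
            \<sim>[at_top] (\<lambda>n. B_const p * beta_const p ^ (n - 1) * real n powr gamma_exponent p
                            * fact (n - 1) ^ p))
       \<and> (\<exists>\<epsilon> :: nat \<Rightarrow> real. \<epsilon> \<in> O(\<lambda>p. 1 / real p) \<and>
            (\<forall>p\<ge>1. B_const p =
               C_coeff p
               * exp (- ((2 * real p + 1) / 2) * integral {1..2} (\<lambda>x :: real. ln (Gamma x)))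
               * (1 + \<epsilon> p)))"
  using ell_asymp_equiv B_const_asymptotics by blast

end
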